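(* Every rooted tree of radius less than or equal to $7$ is long-repetition-free $2$-colorable.
   Context: A word $\bar w$ is a long square if $\bar w = \bar u\bar u$ for some word $\bar u$ with $|\bar u| \ge 3$. A word is long-square-free if it contains no sub-word (that is, no block of consecutive letters) that is a long square. A simple connected graph $G=(V,E)$ is long-repetition-free $k$-colorable if there exists a coloring $\chi : V \to \{1,\dots,k\}$ (any map; adjacent vertices may receive the same color) such that for every path in $G$ with successive vertices $u_1,\dots,u_n$ (a path has pairwise distinct vertices), the word $\chi(u_1)\cdots\chi(u_n)$ is long-square-free. The distance between two vertices of a connected graph is the number of edges in a shortest path between them; the eccentricity of a vertex is the maximum distance from it to any other vertex; the radius of the graph is the minimum eccentricity of its vertices. A rooted tree is a tree with one distinguished vertex, called the root (the radius does not depend on the root). *)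

theory Defs
  imports
    "Graph_Theory.Digraph_Component"
    "Graph_Theory.Vertex_Walk"
    "HOL-Library.Sublist"
    "HOL-Library.Extended_Nat"
begin

definition long_square :: "'c list \<Rightarrow> bool" where
  "long_square w \<longleftrightarrow> (\<exists>u. w = u @ u \<and> length u \<ge> 3)"

definition long_square_free :: "'c list \<Rightarrow> bool" where
  "long_square_free w \<longleftrightarrow> \<not> (\<exists>s. sublist s w \<and> long_square s)"

text \<open>
  A simple graph, possibly infinite, is given by its vertex set and its symmetric, irreflexive
  adjacency relation; this is what \<^locale>\<open>pair_bidirected_digraph\<close> provides.

  The library predicate \<^const>\<open>tree\<close> is unsuitable for such graphs: every edge, traversed back
  and forth, counts as a \<^const>\<open>pre_digraph.cycle\<close> of length 2. The cycles of an undirected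
  simple graph are exactly those of length at least 3. The library notion of connectedness
  includes that there is at least one vertex.
\<close>

definition simple_connected_graph :: "'a pair_pre_digraph \<Rightarrow> bool" where
  "simple_connected_graph G \<longleftrightarrow> pair_bidirected_digraph G \<and> connected (with_proj G)"

definition undirected_tree :: "'a pair_pre_digraph \<Rightarrow> bool" where
  "undirected_tree G \<longleftrightarrow>
     simple_connected_graph G \<and> \<not> (\<exists>p. pre_digraph.cycle (with_proj G) p \<and> length p \<ge> 3)"

definition rooted_tree :: "'a pair_pre_digraph \<Rightarrow> 'a \<Rightarrow> bool" where
  "rooted_tree G r \<longleftrightarrow> undirected_tree G \<and> r \<in> pverts G"

definition graph_dist :: "'a pair_pre_digraph \<Rightarrow> 'a \<Rightarrow> 'a \<Rightarrow> enat" where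
  "graph_dist G u v =
     (INF p \<in> {p. vpath p (with_proj G) \<and> hd p = u \<and> last p = v}. enat (vwalk_length p))"

text \<open>
  Suprema are taken in \<^typ>\<open>enat\<close>: a vertex of an infinite graph with unbounded distances has
  eccentricity \<open>\<infinity>\<close>, and the only vertex of a one-vertex graph has eccentricity 0.
\<close>

definition eccentricity :: "'a pair_pre_digraph \<Rightarrow> 'a \<Rightarrow> enat" where
  "eccentricity G u = (SUP v \<in> pverts G - {u}. graph_dist G u v)"

definition graph_radius :: "'a pair_pre_digraph \<Rightarrow> enat" where
  "graph_radius G = (INF u \<in> pverts G. eccentricity G u)"

definition long_repetition_free_colorable :: "'a pair_pre_digraph \<Rightarrow> nat \<Rightarrow> bool" where
  "long_repetition_free_colorable G k \<longleftrightarrow>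
     (\<exists>\<chi> :: 'a \<Rightarrow> nat. (\<forall>v \<in> pverts G. \<chi> v \<in> {1..k}) \<and>
        (\<forall>p. vpath p (with_proj G) \<longrightarrow> long_square_free (map \<chi> p)))"

end

theory Submission
  imports Defs
begin

text \<open>
  Root the tree at a vertex of minimal eccentricity, so that all levels are at most 7, and give
  all vertices of level \<open>i\<close> the \<open>i\<close>-th letter of \<open>11121222\<close>. Paths in a tree are unique, hence a
  vertex has at most one neighbour of smaller level, and the levels along any path first decrease
  and then increase, by one at each step. So every colour word of a path is a block of one of the
  eight palindromes \<open>a\<^sub>7\<dots>a\<^sub>m\<dots>a\<^sub>7\<close>, which are long-square-free by inspection.
\<close>

section \<open>Long squares\<close>

lemma long_square_free_sublist:
  assumes "long_square_free w" and "sublist v w"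
  shows "long_square_free v"
  using assms sublist_order.order.trans unfolding long_square_free_def by blast

text \<open>An executable test: \<open>n\<close> is the length of the repeated block and ranges over
  a finite list, so concrete words can be checked by evaluation.\<close>

definition long_square_prefix :: "'c list \<Rightarrow> bool" where
  "long_square_prefix w \<longleftrightarrow>
     (\<exists>n \<in> set [3..<Suc (length w div 2)]. take n w = take n (drop n w))"

lemma long_square_prefixI:
  assumes "prefix s w" and "long_square s"
  shows "long_square_prefix w"
proof -
  obtain u z where "w = u @ u @ z" and "length u \<ge> 3"
    using assms by (auto simp: prefix_def long_square_def)
  then show ?thesis
    unfolding long_square_prefix_def by (auto intro!: bexI[of _ "length u"])
qed

lemma long_square_free_Nil: "long_square_free []"
  by (auto simp: long_square_free_def long_square_def)

text \<open>A block of \<open>x # w\<close> is a prefix of it or a block of \<open>w\<close>.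
  Iterated, this reduces long-square-freeness to a prefix test on every suffix.\<close>

lemma long_square_free_ConsI:
  assumes "\<not> long_square_prefix (x # w)" and "long_square_free w"
  shows "long_square_free (x # w)"
  using assms long_square_prefixI unfolding long_square_free_def sublist_Cons_right by blast

section \<open>The colours of the levels and the eight palindromes\<close>

definition level_color :: "nat \<Rightarrow> nat" where
  "level_color i = [1, 1, 1, 2, 1, 2, 2, 2] ! i"

lemma level_color_range:
  assumes "i < 8"
  shows "level_color i \<in> {1..2}"
proof -
  have "\<forall>i \<in> set [0..<8]. level_color i \<in> set [1, 2]"
    by code_simp
  with assms have "level_color i \<in> set [1, 2]" by simp
  then show ?thesis by auto
qed

text \<open>These words belong to the longest paths possible with lowest level \<open>m\<close>:
  from level 7 to level \<open>m\<close> and back to level 7. All eight are verified by evaluating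
  the prefix test on their suffixes.\<close>

lemma long_square_free_level_palindrome:
  assumes "m < 8"
  shows "long_square_free (map level_color (rev [m..<8] @ [Suc m..<8]))"
proof -
  have suffixes: "long_square_free w" if "list_all (\<lambda>v. \<not> long_square_prefix v) (suffixes w)"
    for w :: "nat list"
    using that
    by (induction w) (auto intro: long_square_free_Nil long_square_free_ConsI)
  have "\<forall>m \<in> set [0..<8]. list_all (\<lambda>v. \<not> long_square_prefix v)
      (suffixes (map level_color (rev [m..<8] @ [Suc m..<8])))"
    by code_simp
  with assms show ?thesis by (intro suffixes) auto
qed

lemma long_square_free_level_word:
  assumes "m < 8" and "i \<le> 8" and "j \<le> 8"
  shows "long_square_free (map level_color (rev [m..<i] @ [Suc m..<j]))"
proof (rule long_square_free_sublist)
  show "long_square_free (map level_color (rev [m..<8] @ [Suc m..<8]))"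
    using \<open>m < 8\<close> by (rule long_square_free_level_palindrome)
  have upt: "prefix [k..<l] [k..<8]" if "l \<le> 8" for k l :: nat
    using that upt_add_eq_append[of k l "8 - l"] by (cases "k \<le> l") (auto simp: prefix_def)
  obtain xs ys where "[m..<8] = [m..<i] @ xs" and "[Suc m..<8] = [Suc m..<j] @ ys"
    using upt[OF \<open>i \<le> 8\<close>] upt[OF \<open>j \<le> 8\<close>] unfolding prefix_def by metis
  then have "rev [m..<8] @ [Suc m..<8] = rev xs @ (rev [m..<i] @ [Suc m..<j]) @ ys"
    by simp
  then show "sublist (map level_color (rev [m..<i] @ [Suc m..<j]))
      (map level_color (rev [m..<8] @ [Suc m..<8]))"
    by (intro map_mono_sublist) (metis sublist_appendI)
qed

section \<open>Walks and cycles\<close>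

lemma vwalk_arcs_join: "vwalk_arcs (a @ x # b) = vwalk_arcs (a @ [x]) @ vwalk_arcs (x # b)"
  by (induction a rule: vwalk_arcs.induct) auto

lemma vwalk_join:
  assumes "vwalk (a @ [x]) G" and "vwalk (x # b) G"
  shows "vwalk (a @ x # b) G"
  using assms unfolding vwalk_def vwalk_arcs_join[of a x b] by auto

lemma vwalk_prefix:
  assumes "vwalk (a @ x # b) G"
  shows "vwalk (a @ [x]) G"
  using assms vwalkI_append_l[of "a @ [x]" b G] by simp

lemma vwalk_snocI:
  assumes "vwalk p G" and "v \<in> verts G" and "(last p, v) \<in> arcs_ends G"
  shows "vwalk (p @ [v]) G"
  using assms unfolding vwalk_def by (auto simp: set_vwalk_arcs_snoc)

lemma pawalk_verts_vwalk_arcs: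
  assumes "p \<noteq> []"
  shows "pawalk_verts (hd p) (vwalk_arcs p) = p"
  using assms by (induction p rule: vwalk_arcs.induct) auto

lemma pcas_vwalk_arcs:
  assumes "p \<noteq> []"
  shows "pcas (hd p) (vwalk_arcs p) (last p)"
  using assms by (induction p rule: vwalk_arcs.induct) auto

context pair_pre_digraph
begin

text \<open>Bridges two encodings: paths here are vertex lists, whereas \<open>cycle\<close> speaks
  of arc lists.\<close>

lemma cycle_vwalk_arcs:
  assumes "vwalk p (with_proj G)" and "hd p = last p" and "distinct (tl p)" and "length p \<ge> 2"
  shows "cycle (vwalk_arcs p)"
proof -
  have "p \<noteq> []" and "vwalk_arcs p \<noteq> []"
    using assms(4) by (auto simp: Suc_le_length_iff numeral_2_eq_2)
  then have "awalk (hd p) (vwalk_arcs p) (hd p)"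
    using assms(1) pcas_vwalk_arcs[of p] unfolding awalk_def assms(2)[symmetric]
    by (auto simp: vwalk_def)
  with \<open>p \<noteq> []\<close> \<open>vwalk_arcs p \<noteq> []\<close> show ?thesis
    unfolding cycle_def using assms(3) pawalk_verts_vwalk_arcs[of p] by auto
qed

end

context pair_sym_digraph
begin

lemma vwalk_rev:
  assumes "vwalk p (with_proj G)"
  shows "vwalk (rev p) (with_proj G)"
proof -
  have "(y, x) \<in> parcs G" if "(x, y) \<in> parcs G" for x y
    using that pair_sym_arcs by (auto simp: symmetric_def elim: symE)
  then show ?thesis
    using assms by (auto simp: vwalk_def set_vwalk_arcs_rev)
qed

text \<open>Where two paths with the same ends first diverge, at \<open>u\<close>, follow both until
  they meet again at \<open>x\<close>; the two segments from \<open>u\<close> to \<open>x\<close>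
  close up to a cycle.\<close>

lemma acyclic_vpath_unique:
  assumes acyclic: "\<not> (\<exists>p. cycle p \<and> length p \<ge> 3)"
    and "vpath p (with_proj G)" and "vpath q (with_proj G)"
    and "hd p = hd q" and "last p = last q"
  shows "p = q"
  using assms(2-)
proof (induction p arbitrary: q)
  case Nil
  then show ?case by (simp add: vpath_def vwalk_def)
next
  case (Cons u p)
  obtain q' where q: "q = u # q'"
    using Cons.prems by (cases q) (auto simp: vpath_def vwalk_def)
  \<comment> \<open>If one path stops at \<open>u\<close>, so must the other: both end in
    \<open>u\<close>, and a path visits \<open>u\<close> only once.\<close>
  have "p = [] \<longleftrightarrow> q' = []"
    using Cons.prems last_in_set unfolding q vpath_def by (metis distinct.simps(2) last.simps)
  show ?case
  proof (cases "p = [] \<or> q' = []")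
    case True
    with \<open>p = [] \<longleftrightarrow> q' = []\<close> q show ?thesis by simp
  next
    case False
    then have "p \<noteq> []" and "q' \<noteq> []" by auto
    then have vp: "vpath p (with_proj G)" and vq: "vpath q' (with_proj G)"
      using Cons.prems unfolding q by (auto simp: vpath_def elim: vwalk_consE)
    have "last p = last q'"
      using Cons.prems \<open>p \<noteq> []\<close> \<open>q' \<noteq> []\<close> unfolding q by simp
    show ?thesis
    proof (cases "hd p = hd q'")
      case True
      with Cons.IH[OF vp vq] \<open>last p = last q'\<close> q show ?thesis by simp
    next
      case neq: False
      have "\<exists>x \<in> set p. x \<in> set q'"
        using \<open>last p = last q'\<close> \<open>p \<noteq> []\<close> \<open>q' \<noteq> []\<close> by (metis last_in_set)
      \<comment> \<open>Taking the first vertex of \<open>p\<close> on \<open>q'\<close> keeps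
        \<open>p1\<close> disjoint from \<open>q'\<close>, hence the closed walk below has no inner
        repetition.\<close>
      then obtain p1 x p2 where p: "p = p1 @ x # p2" and "x \<in> set q'"
        and disj: "\<forall>y \<in> set p1. y \<notin> set q'"
        by (elim split_list_first_propE) blast
      obtain q1 q2 where q': "q' = q1 @ x # q2"
        using \<open>x \<in> set q'\<close> by (auto dest: split_list)
      \<comment> \<open>Out along \<open>p\<close> as far as \<open>x\<close>, back to
        \<open>u\<close> along the reverse of \<open>q\<close>.\<close>
      let ?w = "u # p1 @ x # rev q1 @ [u]"
      have "vwalk ((u # p1) @ [x]) (with_proj G)"
        using Cons.prems(1) vwalk_prefix[of "u # p1" x p2 "with_proj G"] unfolding p vpath_def by simp
      moreover have "vwalk ((u # q1) @ [x]) (with_proj G)"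
        using Cons.prems(2) vwalk_prefix[of "u # q1" x q2 "with_proj G"] unfolding q q' vpath_def by simp
      then have "vwalk (x # rev q1 @ [u]) (with_proj G)"
        using vwalk_rev by force
      ultimately have "vwalk ?w (with_proj G)"
        using vwalk_join[of "u # p1" x] by simp
      moreover have "distinct (tl ?w)"
        using Cons.prems(1,2) disj unfolding p q q' vpath_def by auto
      ultimately have "cycle (vwalk_arcs ?w)"
        by (intro cycle_vwalk_arcs) auto
      \<comment> \<open>Were both segments empty, both paths would continue from \<open>u\<close> to
        \<open>x\<close>. So the closed walk is not a single edge traversed back and forth, which
        the acyclicity assumption permits.\<close>
      moreover have "p1 \<noteq> [] \<or> q1 \<noteq> []"
        using neq unfolding p q' by auto
      then have "vwalk_length ?w \<ge> 3"
        unfolding vwalk_length_simp by (auto simp: neq_Nil_conv)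
      ultimately show ?thesis
        using acyclic unfolding vwalk_length_def by blast
    qed
  qed
qed

end

section \<open>Levels along a path\<close>

text \<open>A local maximum of the level inside a path would have the same parent before and after
  it, contradicting distinctness. Here \<open>m\<close> is the lowest level; the path starts at
  level \<open>i - 1\<close>, and \<open>j \<le> Suc m\<close> means that it never ascends.\<close>

lemma vpath_levels_unimodal:
  fixes level :: "'a \<Rightarrow> nat"
  assumes step: "\<And>u v. (u, v) \<in> arcs_ends G \<Longrightarrow> level v = Suc (level u) \<or> level u = Suc (level v)"
    and parent: "\<And>u v w. (u, v) \<in> arcs_ends G \<Longrightarrow> (v, w) \<in> arcs_ends G \<Longrightarrow>
      level v = Suc (level u) \<Longrightarrow> level v = Suc (level w) \<Longrightarrow> u = w"
    and "vpath p G"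
  shows "\<exists>m i j. m < i \<and> map level p = rev [m..<i] @ [Suc m..<j]"
  using \<open>vpath p G\<close>
proof (induction p)
  case Nil
  then show ?case by (simp add: vpath_def vwalk_def)
next
  case (Cons x p)
  show ?case
  proof (cases p)
    case Nil
    then have "map level (x # p) = rev [level x..<Suc (level x)] @ [Suc (level x)..<0]" by simp
    then show ?thesis by (metis lessI)
  next
    case p: (Cons y ys)
    have xy: "(x, y) \<in> arcs_ends G" and "vpath p G"
      using Cons.prems unfolding p by (auto simp: vpath_def elim: vwalk_consE)
    then obtain m i j where "m < i" and map: "map level p = rev [m..<i] @ [Suc m..<j]"
      using Cons.IH by auto
    then obtain i' where i: "i = Suc i'" and "m \<le> i'"
      by (cases i) auto
    have y: "level y = i'" and ys: "map level ys = rev [m..<i'] @ [Suc m..<j]"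
      using map \<open>m \<le> i'\<close> unfolding p i by auto
    consider "level x = Suc i'" | "i' = Suc (level x)"
      using step[OF xy] y by auto
    then show ?thesis
    proof cases
      case 1
      then have "map level (x # p) = rev [m..<Suc i] @ [Suc m..<j]"
        using map \<open>m \<le> i'\<close> unfolding i by simp
      then show ?thesis using \<open>m < i\<close> less_SucI by blast
    next
      case 2
      \<comment> \<open>The path ascends from \<open>x\<close> to \<open>y\<close>. If it descended
        after \<open>y\<close>, the next vertex \<open>z\<close> would be a parent of
        \<open>y\<close> as well, hence equal to \<open>x\<close>.\<close>
      have "i' = m"
      proof (rule ccontr)
        assume "i' \<noteq> m"
        with \<open>m \<le> i'\<close> 2 have "[m..<i'] = [m..<level x] @ [level x]" by simp
        with ys obtain z zs where z: "ys = z # zs" and "level z = level x"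
          by (auto simp: map_eq_Cons_conv)
        moreover have "(y, z) \<in> arcs_ends G"
          using \<open>vpath p G\<close> unfolding p z by (auto simp: vpath_def elim: vwalk_consE)
        ultimately have "x = z"
          using parent[OF xy] 2 y by simp
        with Cons.prems show False unfolding p z by (simp add: vpath_def)
      qed
      \<comment> \<open>The maximum is needed when \<open>p\<close> has no ascent: \<open>j\<close>
        may then lie below \<open>Suc m\<close>, but the new ascent must still contain the level
        \<open>m\<close> of \<open>y\<close>.\<close>
      then have "map level (x # p) = rev [level x..<Suc (level x)] @ [Suc (level x)..<max j (Suc m)]"
        using 2 map unfolding i by (auto simp: max_def upt_conv_Cons)
      then show ?thesis by (metis lessI)
    qed
  qed
qed

section \<open>Colouring by levels\<close>

text \<open>An infimum strictly below \<open>n\<close> has a witness below \<open>n\<close>. Fewer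
  than \<open>n\<close> edges means at most \<open>n\<close> vertices.\<close>

lemma graph_dist_lessE:
  assumes "graph_dist G u v < enat n"
  obtains p where "vpath p (with_proj G)" and "hd p = u" and "last p = v" and "length p \<le> n"
proof -
  obtain p where p: "vpath p (with_proj G)" "hd p = u" "last p = v" "vwalk_length p < n"
    using assms unfolding graph_dist_def INF_less_iff by auto
  moreover have "length p \<le> n"
    using p(4) by auto
  ultimately show thesis using that by blast
qed

theorem proposition2p2:
  fixes G :: "'a pair_pre_digraph" and r :: 'a
  assumes "rooted_tree G r"
    and "graph_radius G \<le> 7"
  shows "long_repetition_free_colorable G 2"
proof -
  interpret pair_bidirected_digraph G
    using assms(1) by (simp add: rooted_tree_def undirected_tree_def simple_connected_graph_def)
  have acyclic: "\<not> (\<exists>p. cycle p \<and> length p \<ge> 3)"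
    using assms(1) by (simp add: rooted_tree_def undirected_tree_def)
  \<comment> \<open>The strict bound lets the infimum yield an actual vertex \<open>c\<close>, from
    which levels are measured.\<close>
  have "graph_radius G < enat 8"
    using assms(2) by (rule le_less_trans) (simp add: numeral_eq_enat)
  then obtain c where c: "c \<in> pverts G" and ecc: "eccentricity G c < enat 8"
    unfolding graph_radius_def INF_less_iff by blast
  \<comment> \<open>The eccentricity ranges over vertices other than \<open>c\<close>, so
    \<open>c\<close> itself gets the one-vertex path separately.\<close>
  have "\<exists>p. vpath p (with_proj G) \<and> hd p = c \<and> last p = v \<and> length p \<le> 8"
    if "v \<in> pverts G" for v
  proof (cases "v = c")
    case True
    with c have "vpath [c] (with_proj G)" by (intro vpath_self) simp
    with True show ?thesis by (intro exI[of _ "[c]"]) simp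
  next
    case False
    with that have "graph_dist G c v \<le> eccentricity G c"
      unfolding eccentricity_def by (intro SUP_upper) simp
    then have "graph_dist G c v < enat 8" using ecc by (rule le_less_trans)
    then show ?thesis by (metis graph_dist_lessE)
  qed
  then obtain \<pi> where \<pi>: "\<And>v. v \<in> pverts G \<Longrightarrow>
      vpath (\<pi> v) (with_proj G) \<and> hd (\<pi> v) = c \<and> last (\<pi> v) = v \<and> length (\<pi> v) \<le> 8"
    by metis
  have \<pi>_unique: "p = \<pi> v"
    if "vpath p (with_proj G)" "hd p = c" "last p = v" for p v
  proof -
    have "v \<in> pverts G"
      using that by (auto simp: vpath_def vwalk_def)
    with \<pi>[of v] show ?thesis
      using that by (intro acyclic_vpath_unique[OF acyclic]) auto
  qed
  have nonempty: "\<pi> v \<noteq> []" if "v \<in> pverts G" for v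
    using \<pi>[OF that] by (auto simp: vpath_def vwalk_def)
  \<comment> \<open>Appending \<open>v\<close> to \<open>\<pi> u\<close> gives a path from
    \<open>c\<close> to \<open>v\<close>, and there is only one.\<close>
  have extend: "\<pi> v = \<pi> u @ [v]" if uv: "(u, v) \<in> parcs G" and "v \<notin> set (\<pi> u)" for u v
  proof (rule sym, rule \<pi>_unique)
    have u: "u \<in> pverts G" and v: "v \<in> pverts G" using uv by (auto dest: wellformed')
    show "vpath (\<pi> u @ [v]) (with_proj G)"
      using \<pi>[OF u] uv v \<open>v \<notin> set (\<pi> u)\<close> by (auto simp: vpath_def intro: vwalk_snocI)
    show "hd (\<pi> u @ [v]) = c" using \<pi>[OF u] nonempty[OF u] by simp
  qed simp
  \<comment> \<open>If \<open>v\<close> lies on \<open>\<pi> u\<close>, the part up to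
    \<open>v\<close> is \<open>\<pi> v\<close> by uniqueness. It avoids \<open>u\<close>, so
    \<open>extend\<close> applies with the roles exchanged.\<close>
  have adjacent: "\<pi> v = \<pi> u @ [v] \<or> \<pi> u = \<pi> v @ [u]" if uv: "(u, v) \<in> parcs G" for u v
  proof (cases "v \<in> set (\<pi> u)")
    case True
    have u: "u \<in> pverts G" and "u \<noteq> v" using uv pair_no_loops[OF uv] by (auto dest: wellformed')
    have vu: "(v, u) \<in> parcs G"
      using uv pair_sym_arcs by (auto simp: symmetric_def elim: symE)
    obtain a b where ab: "\<pi> u = a @ v # b" using True by (auto dest: split_list)
    have "vpath (a @ [v]) (with_proj G)"
      using \<pi>[OF u] vwalk_prefix[of a v b] unfolding ab by (auto simp: vpath_def)
    moreover have "hd (a @ [v]) = c"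
      using \<pi>[OF u] unfolding ab by (cases a) auto
    ultimately have "a @ [v] = \<pi> v" by (intro \<pi>_unique) auto
    moreover have "b \<noteq> []" and "last b = u"
      using \<pi>[OF u] \<open>u \<noteq> v\<close> unfolding ab by (auto split: if_splits)
    then have "u \<notin> set (a @ [v])"
      using \<pi>[OF u] last_in_set[of b] unfolding ab vpath_def by auto
    ultimately show ?thesis using extend[OF vu] by auto
  qed (use extend uv in blast)
  define level where "level v = length (\<pi> v) - 1" for v
  have length_\<pi>: "length (\<pi> v) = Suc (level v)" if "v \<in> pverts G" for v
    using nonempty[OF that] unfolding level_def by simp
  have level_less: "level v < 8" if "v \<in> pverts G" for v
    using length_\<pi>[OF that] \<pi>[OF that] by simp
  have step: "level v = Suc (level u) \<or> level u = Suc (level v)" if "(u, v) \<in> parcs G" for u v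
    using adjacent[OF that] length_\<pi> wellformed'[OF that]
    by (metis Suc_inject length_append_singleton)
  have parent: "u = w"
    if uv: "(u, v) \<in> parcs G" and vw: "(v, w) \<in> parcs G"
      and "level v = Suc (level u)" and "level v = Suc (level w)" for u v w
  proof -
    have verts: "u \<in> pverts G" "v \<in> pverts G" "w \<in> pverts G"
      using uv vw by (auto dest: wellformed')
    \<comment> \<open>Comparing lengths excludes the other alternative of \<open>adjacent\<close>; a
      parent of \<open>v\<close> is thus the last vertex but one of \<open>\<pi> v\<close>.\<close>
    have "\<pi> v = \<pi> u @ [v]" and "\<pi> v = \<pi> w @ [v]"
      using adjacent[OF uv] adjacent[OF vw] length_\<pi>[OF verts(1)] length_\<pi>[OF verts(2)]
        length_\<pi>[OF verts(3)] that(3,4) by (auto dest: arg_cong[where f = length])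
    then have "last (\<pi> u) = last (\<pi> w)" by simp
    with \<pi> verts show "u = w" by metis
  qed
  have "long_square_free (map (level_color \<circ> level) p)" if p: "vpath p (with_proj G)" for p
  proof -
    have "\<exists>m i j. m < i \<and> map level p = rev [m..<i] @ [Suc m..<j]"
      by (rule vpath_levels_unimodal[OF _ _ p]) (use step parent in simp_all)
    then obtain m i j where "m < i" and map: "map level p = rev [m..<i] @ [Suc m..<j]"
      by blast
    have "set (map level p) \<subseteq> {..<8}"
      using p level_less by (auto simp: vpath_def vwalk_def)
    then have levels: "k < 8" if "k \<in> {m..<i} \<union> {Suc m..<j}" for k
      using that unfolding map by auto
    \<comment> \<open>The largest entry \<open>i - 1\<close> of the descent is the level of a
      vertex. For \<open>j\<close> the same holds if there is an ascent; otherwise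
      \<open>j \<le> Suc m\<close>.\<close>
    have "i \<le> 8" using levels[of "i - 1"] \<open>m < i\<close> by (cases i) auto
    then have "m < 8" using \<open>m < i\<close> by simp
    then have "j \<le> 8" using levels[of "j - 1"] by (cases "Suc m < j"; cases j) auto
    with \<open>m < 8\<close> \<open>i \<le> 8\<close> have "long_square_free (map level_color (map level p))"
      unfolding map by (intro long_square_free_level_word)
    then show ?thesis by simp
  qed
  moreover have "(level_color \<circ> level) v \<in> {1..2}" if "v \<in> pverts G" for v
    using level_color_range[OF level_less[OF that]] by simp
  ultimately show ?thesis
    unfolding long_repetition_free_colorable_def by blast
qed

end
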